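(* Let $A$ and $B$ be two elements of an associative algebra over $\mathbb{C}$ with unit element $I$ satisfying $AB-BA=I$. (a) Let $A_1=A$, and let $A_2$ and $A_3$ both be polynomials in the (non-commuting) elements $A$ and $B$ with complex coefficients. Then the relations $$A_1A_2+A_2A_1=A_3,\qquad A_1A_3+A_3A_1=0$$ can be satisfied only if $A_2=A_3=0$. (b) Let $A_1=A$, and let $A_2$ and $A_3$ be formal power series in $A$ and $B$ in $(B,A)$-normal form, $$A_2=\sum_{j=0}^{\infty}\sum_{k=0}^{\infty}a_{jk}B^jA^k,\qquad A_3=\sum_{j=0}^{\infty}\sum_{k=0}^{\infty}\tilde a_{jk}B^jA^k,$$ with $a_{jk},\tilde a_{jk}\in\mathbb{C}$. Then $A_1,A_2,A_3$ satisfy $$A_1A_2+A_2A_1=A_3,\qquad A_1A_3+A_3A_1=0$$ if and only if there exist formal power series $V(A)=\sum_{l\ge 0}v_lA^l$ and $W(A)=\sum_{l\ge 0}w_lA^l$ with complex coefficients such that $$A_2=T(A,B)V(A)+B\,T(A,B)W(A),\qquad A_3=T(A,B)W(A),$$ where $$T(A,B)=\sum_{k=0}^{\infty}\frac{(-2)^k}{k!}B^kA^k.$$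
   Context: A formal power series in $A$ and $B$ in $(B,A)$-normal form is a formal expression $\sum_{j,k\ge 0}a_{jk}B^jA^k$ with $a_{jk}\in\mathbb{C}$ (in every monomial all $B$'s stand to the left of all $A$'s). Two such formal series are equal if and only if all their coefficients coincide. Products of formal series are computed by bilinear extension of the reordering rule that follows from $AB-BA=I$, $$(B^jA^k)(B^mA^n)=\sum_{\nu=0}^{\min(k,m)}\nu!\binom{k}{\nu}\binom{m}{\nu}B^{j+m-\nu}A^{k+n-\nu},$$ a product being defined when each coefficient of the result is a sum with only finitely many non-zero terms. A series in $A$ alone, or in $B$ alone, is a special case. *)

theory Defs
  imports Complex_Main "HOL-Library.Function_Algebras" "HOL-Library.Groups_Big_Fun"
begin

(* The sort {ring, monoid_mult} instead of ring_1 only avoids excluding the zero algebra. *)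
locale complex_algebra = vector_space scale
  for scale :: "complex \<Rightarrow> 'a::{ring,monoid_mult} \<Rightarrow> 'a" +
  assumes scale_mult_left: "scale c x * y = scale c (x * y)"
    and scale_mult_right: "x * scale c y = scale c (x * y)"

(* Linear combinations of words in the (non-commuting) elements of S; the empty word is the unit. *)
definition (in complex_algebra) polynomials_in :: "'a set \<Rightarrow> 'a set" where
  "polynomials_in S = span (prod_list ` lists S)"

(* X j k is the coefficient of B^j A^k.  Equality is equality of all coefficients; addition and 0
   are the pointwise ones of Function_Algebras.  The pointwise product there is NOT the product of
   series, which is nf_mult below. *)
type_synonym nf_series = "nat \<Rightarrow> nat \<Rightarrow> complex"

(* The coefficient of B^p A^q in (B^j A^k)(B^m A^n). *)
definition reorder_coeff :: "nat \<Rightarrow> nat \<Rightarrow> nat \<Rightarrow> nat \<Rightarrow> nat \<Rightarrow> nat \<Rightarrow> complex" where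
  "reorder_coeff j k m n p q =
     (\<Sum>\<nu> = 0..min k m.
        if p = j + m - \<nu> \<and> q = k + n - \<nu>
        then fact \<nu> * of_nat (k choose \<nu>) * of_nat (m choose \<nu>) else 0)"

definition nf_mult_term ::
    "nf_series \<Rightarrow> nf_series \<Rightarrow> nat \<Rightarrow> nat \<Rightarrow> nat \<times> nat \<times> nat \<times> nat \<Rightarrow> complex" where
  "nf_mult_term X Y p q = (\<lambda>(j, k, m, n). X j k * Y m n * reorder_coeff j k m n p q)"

definition nf_mult_defined :: "nf_series \<Rightarrow> nf_series \<Rightarrow> bool" where
  "nf_mult_defined X Y \<longleftrightarrow> (\<forall>p q. finite {i. nf_mult_term X Y p q i \<noteq> 0})"

(* Meaningful only if nf_mult_defined X Y: Sum_any is 0 when infinitely many terms are non-zero. *)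
definition nf_mult :: "nf_series \<Rightarrow> nf_series \<Rightarrow> nf_series" (infixl "\<odot>" 70) where
  "X \<odot> Y = (\<lambda>p q. Sum_any (nf_mult_term X Y p q))"

definition nf_A :: nf_series where
  "nf_A = (\<lambda>j k. if j = 0 \<and> k = 1 then 1 else 0)"

definition nf_B :: nf_series where
  "nf_B = (\<lambda>j k. if j = 1 \<and> k = 0 then 1 else 0)"

definition series_in_A :: "(nat \<Rightarrow> complex) \<Rightarrow> nf_series" where
  "series_in_A v = (\<lambda>j k. if j = 0 then v k else 0)"

definition nf_T :: nf_series where
  "nf_T = (\<lambda>j k. if j = k then (- 2) ^ k / fact k else 0)"

end

theory Submission
  imports Defs
begin

text \<open>
  Both parts are about the anticommutator map \<open>L X = A X + X A\<close>: the relations say \<open>L A2 = A3\<close> and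
  \<open>L A3 = 0\<close>.

  For polynomials, \<open>L\<close> is injective.  Write \<open>ad a x = a x - x a\<close>.  If \<open>A X = - X A\<close>, then
  \<open>ad A X = -2 X A\<close>, and iterating gives \<open>(ad A)^n X = (-2)^n X A^n\<close>.  On polynomials \<open>ad A\<close> is locally
  nilpotent, because it sends the generators \<open>A\<close>, \<open>B\<close> to scalars; hence \<open>X A^n = 0\<close> for some \<open>n\<close>.
  The same local nilpotency of \<open>ad B\<close>, which sends \<open>A\<close> to the non-zero scalar \<open>-1\<close>, makes right
  multiplication by \<open>A\<close> injective on polynomials (\<open>right_mult_cancel\<close>), so \<open>X = 0\<close>.

  For series this argument breaks down, since \<open>ad A\<close> is no longer locally nilpotent.  Instead,
  the coefficient of \<open>B^p A^q\<close> in \<open>L X\<close> is \<open>2 x(p, q-1) + (p+1) x(p+1, q)\<close>, with \<open>x(p, -1) = 0\<close>.  Hence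
  \<open>L X\<close> together with the row \<open>x(0, _)\<close> determines \<open>X\<close>, one power of \<open>B\<close> at a time
  (\<open>anticomm_row_determined\<close>).  The series \<open>T V\<close> has row \<open>V\<close> and lies in the kernel of \<open>L\<close>; the
  series \<open>B T W\<close> has row \<open>0\<close> and is mapped to \<open>T W\<close>.  So the displayed solutions exist, and with
  \<open>V\<close> and \<open>W\<close> taken to be the rows of \<open>A2\<close> and \<open>A3\<close> they are all solutions.
\<close>

section \<open>Polynomials in elements with scalar commutators\<close>

definition ad :: "'a::ring \<Rightarrow> 'a \<Rightarrow> 'a" where
  "ad a x = a * x - x * a"

lemma ad_zero [simp]: "ad a 0 = 0"
  by (simp add: ad_def)

lemma ad_funpow_zero [simp]: "(ad a ^^ n) 0 = 0"
  by (induction n) auto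

lemma ad_add: "ad a (x + y) = ad a x + ad a y"
  by (simp add: ad_def algebra_simps)

lemma ad_funpow_add: "(ad a ^^ n) (x + y) = (ad a ^^ n) x + (ad a ^^ n) y"
  by (induction n) (auto simp: ad_add)

lemma ad_funpow_vanishes_above:
  assumes "(ad a ^^ n) x = 0" and "n \<le> m"
  shows "(ad a ^^ m) x = 0"
proof -
  have "(ad a ^^ (m - n + n)) x = 0"
    by (simp only: funpow_add o_apply assms(1) ad_funpow_zero)
  then show ?thesis
    using assms(2) by simp
qed

definition ad_nilpotent_at :: "'a::ring \<Rightarrow> 'a \<Rightarrow> bool" where
  "ad_nilpotent_at a x \<longleftrightarrow> (\<exists>n. (ad a ^^ n) x = 0)"

context complex_algebra
begin

lemma ad_scale: "ad a (scale c x) = scale c (ad a x)"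
  by (simp add: ad_def scale_mult_left scale_mult_right scale_right_diff_distrib)

lemma ad_funpow_scale: "(ad a ^^ n) (scale c x) = scale c ((ad a ^^ n) x)"
  by (induction n) (auto simp: ad_scale)

text \<open>
  Leibniz's rule for a right factor \<open>g\<close> whose higher derivatives vanish.  At \<open>n = 0\<close> the truncated
  exponent \<open>n - 1\<close> is harmless, as its term has the factor \<open>n\<close>.
\<close>
lemma ad_funpow_mult_right:
  assumes "ad a g = scale s 1"
  shows "(ad a ^^ n) (x * g) = (ad a ^^ n) x * g + scale (of_nat n * s) ((ad a ^^ (n - 1)) x)"
proof (induction n)
  case 0
  show ?case by simp
next
  case (Suc n)
  have leibniz: "ad a (y * g) = ad a y * g + scale s y" for y
  proof -
    have "ad a (y * g) = ad a y * g + y * ad a g"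
      by (simp add: ad_def algebra_simps)
    then show ?thesis
      by (simp add: assms scale_mult_right)
  qed
  have "scale (of_nat n * s) (ad a ((ad a ^^ (n - 1)) x)) = scale (of_nat n * s) ((ad a ^^ n) x)"
    by (cases n) auto
  then show ?case
    by (simp add: Suc.IH ad_add ad_scale leibniz algebra_simps)
qed

lemma ad_nilpotent_at_mult_right:
  assumes "ad a g = scale s 1" and "ad_nilpotent_at a x"
  shows "ad_nilpotent_at a (x * g)"
proof -
  obtain n where "(ad a ^^ n) x = 0"
    using assms(2) by (auto simp: ad_nilpotent_at_def)
  then have "(ad a ^^ Suc n) (x * g) = 0"
    by (subst ad_funpow_mult_right[OF assms(1)]) simp
  then show ?thesis
    unfolding ad_nilpotent_at_def by blast
qed

text \<open>
  By Leibniz's rule, each further letter of a word raises the order of nilpotency by at most one.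
\<close>
lemma ad_nilpotent_at_polynomial:
  assumes "\<And>g. g \<in> S \<Longrightarrow> \<exists>s. ad a g = scale s 1" and "x \<in> polynomials_in S"
  shows "ad_nilpotent_at a x"
proof -
  have word: "ad_nilpotent_at a (prod_list gs)" if "gs \<in> lists S" for gs
    using that
  proof (induction gs rule: rev_induct)
    case Nil
    have "(ad a ^^ 1) 1 = 0"
      by (simp add: ad_def)
    then show ?case
      unfolding ad_nilpotent_at_def by (metis prod_list.Nil)
  next
    case (snoc g gs)
    then show ?case
      using assms(1)[of g] ad_nilpotent_at_mult_right by auto
  qed
  have "x \<in> span (prod_list ` lists S)"
    using assms(2) by (simp add: polynomials_in_def)
  then show ?thesis
  proof (induction rule: span_induct_alt)
    case base
    show ?case
      unfolding ad_nilpotent_at_def by (metis ad_funpow_zero)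
  next
    case (step c w y)
    obtain n m where "(ad a ^^ n) w = 0" "(ad a ^^ m) y = 0"
      using step word unfolding ad_nilpotent_at_def by blast
    then have "(ad a ^^ max n m) w = 0" "(ad a ^^ max n m) y = 0"
      using ad_funpow_vanishes_above by (meson max.cobounded1 max.cobounded2)+
    then have "(ad a ^^ max n m) (scale c w + y) = 0"
      by (simp add: ad_funpow_add ad_funpow_scale)
    then show ?case
      unfolding ad_nilpotent_at_def by blast
  qed
qed

text \<open>
  If \<open>x g = 0\<close> then Leibniz's rule expresses \<open>(ad b)^m x\<close> through \<open>(ad b)^(m+1) x\<close>, so the vanishing
  of a high power of \<open>ad b\<close> at \<open>x\<close> descends to \<open>x\<close> itself.
\<close>
lemma right_mult_cancel:
  assumes "ad b g = scale s 1" and "s \<noteq> 0" and "ad_nilpotent_at b x" and "x * g = 0"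
  shows "x = 0"
proof -
  have "x = 0" if "(ad b ^^ n) x = 0" for n
    using that
  proof (induction n)
    case 0
    then show ?case by simp
  next
    case (Suc m)
    have "(ad b ^^ Suc m) (x * g) =
        (ad b ^^ Suc m) x * g + scale (of_nat (Suc m) * s) ((ad b ^^ m) x)"
      using ad_funpow_mult_right[OF assms(1), of "Suc m" x] by simp
    then have "scale (of_nat (Suc m) * s) ((ad b ^^ m) x) = 0"
      using Suc.prems assms(4) by (metis ad_funpow_zero add_0 mult_zero_left)
    then have "(ad b ^^ m) x = 0"
      using assms(2) by (simp del: of_nat_Suc)
    then show ?case
      by (rule Suc.IH)
  qed
  then show ?thesis
    using assms(3) by (auto simp: ad_nilpotent_at_def)
qed

lemma right_mult_power_cancel:
  assumes "ad b g = scale s 1" and "s \<noteq> 0" and "ad_nilpotent_at b x" and "x * g ^ n = 0"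
  shows "x = 0"
  using assms(3,4)
proof (induction n arbitrary: x)
  case 0
  then show ?case by simp
next
  case (Suc n)
  have "x * g = 0"
    using Suc.IH[of "x * g"] Suc.prems ad_nilpotent_at_mult_right[OF assms(1)]
    by (simp add: mult.assoc)
  then show ?case
    using right_mult_cancel[OF assms(1,2)] Suc.prems by blast
qed

lemma ad_funpow_anticommuting:
  assumes "a * x + x * a = 0"
  shows "(ad a ^^ n) x = scale ((- 2) ^ n) (x * a ^ n)"
proof (induction n)
  case 0
  show ?case by simp
next
  case (Suc n)
  have "scale (- 2) y = - y - y" for y
    using scale_left_diff_distrib[of "- 1" 1 y] by simp
  moreover have "ad a x = - (x * a) - x * a"
    using assms by (simp add: ad_def eq_neg_iff_add_eq_0)
  ultimately have ad_x: "ad a x = scale (- 2) (x * a)"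
    by simp
  have "ad a (x * a ^ n) = ad a x * a ^ n"
    by (simp add: ad_def left_diff_distrib mult.assoc power_commutes)
  also have "\<dots> = scale (- 2) (x * a ^ Suc n)"
    by (simp add: ad_x scale_mult_left mult.assoc)
  finally show ?case
    by (simp add: Suc.IH ad_scale mult.commute)
qed

theorem anticommuting_polynomial_eq_0:
  assumes ccr: "A * B - B * A = 1" and X: "X \<in> polynomials_in {A, B}"
    and anti: "A * X + X * A = 0"
  shows "X = 0"
proof -
  have "ad A A = scale 0 1" "ad A B = scale 1 1" "ad B B = scale 0 1"
    using ccr by (auto simp: ad_def)
  moreover have BA: "ad B A = scale (- 1) 1"
    using arg_cong[OF ccr, of uminus] by (simp add: ad_def)
  ultimately have gen: "\<exists>s. ad a g = scale s 1" if "a \<in> {A, B}" "g \<in> {A, B}" for a g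
    using that by blast
  have "ad_nilpotent_at A X" and nil_B: "ad_nilpotent_at B X"
    using ad_nilpotent_at_polynomial[OF gen X] by auto
  then obtain n where "(ad A ^^ n) X = 0"
    by (auto simp: ad_nilpotent_at_def)
  then have "X * A ^ n = 0"
    by (simp add: ad_funpow_anticommuting[OF anti])
  then show ?thesis
    using right_mult_power_cancel[OF BA _ nil_B] by simp
qed

end

section \<open>Products of normally ordered series\<close>

lemma nf_mult_eq_sum:
  assumes "finite S" and "\<And>i. nf_mult_term X Y p q i \<noteq> 0 \<Longrightarrow> i \<in> S"
  shows "(X \<odot> Y) p q = sum (nf_mult_term X Y p q) S"
  unfolding nf_mult_def using assms by (intro Sum_any.expand_superset) auto

lemma nf_mult_definedI:
  assumes "\<And>p q. finite (S p q)" and "\<And>p q i. nf_mult_term X Y p q i \<noteq> 0 \<Longrightarrow> i \<in> S p q"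
  shows "nf_mult_defined X Y"
  unfolding nf_mult_defined_def
proof (intro allI)
  show "finite {i. nf_mult_term X Y p q i \<noteq> 0}" for p q
    by (rule finite_subset[OF _ assms(1)[of p q]]) (use assms(2) in blast)
qed

lemma reorder_coeff_A_left:
  "reorder_coeff 0 1 m n p q =
     (if p = m \<and> q = Suc n then 1 else if m = Suc p \<and> q = n then of_nat m else 0)"
  by (cases m) (auto simp: reorder_coeff_def)

lemma reorder_coeff_no_A_left:
  "reorder_coeff j 0 m n p q = (if p = j + m \<and> q = n then 1 else 0)"
  by (auto simp: reorder_coeff_def)

lemma reorder_coeff_no_B_right:
  "reorder_coeff j k 0 n p q = (if p = j \<and> q = k + n then 1 else 0)"
  by (auto simp: reorder_coeff_def)

lemma nf_A_mult_support:
  "nf_mult_term nf_A X p q i \<noteq> 0 \<Longrightarrow> i \<in> {(0, 1, p, q - 1), (0, 1, Suc p, q)}"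
  by (auto simp: nf_mult_term_def nf_A_def reorder_coeff_A_left[unfolded One_nat_def]
      split: prod.splits if_splits)

lemma nf_mult_defined_A_left: "nf_mult_defined nf_A X"
  by (rule nf_mult_definedI[OF _ nf_A_mult_support]) auto

lemma nf_A_mult:
  "(nf_A \<odot> X) p q = (if q = 0 then 0 else X p (q - 1)) + of_nat (Suc p) * X (Suc p) q"
  by (subst nf_mult_eq_sum[OF _ nf_A_mult_support])
    (auto simp: nf_mult_term_def nf_A_def reorder_coeff_A_left[unfolded One_nat_def])

lemma nf_B_mult_support:
  "nf_mult_term nf_B X p q i \<noteq> 0 \<Longrightarrow> i \<in> {(1, 0, p - 1, q)}"
  by (auto simp: nf_mult_term_def nf_B_def reorder_coeff_no_A_left split: prod.splits if_splits)

lemma nf_mult_defined_B_left: "nf_mult_defined nf_B X"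
  by (rule nf_mult_definedI[OF _ nf_B_mult_support]) auto

lemma nf_B_mult: "(nf_B \<odot> X) p q = (if p = 0 then 0 else X (p - 1) q)"
  by (subst nf_mult_eq_sum[OF _ nf_B_mult_support])
    (auto simp: nf_mult_term_def nf_B_def reorder_coeff_no_A_left)

lemma mult_series_in_A_support:
  "nf_mult_term X (series_in_A v) p q i \<noteq> 0 \<Longrightarrow> i \<in> (\<lambda>k. (p, k, 0, q - k)) ` {..q}"
  by (auto simp: nf_mult_term_def series_in_A_def reorder_coeff_no_B_right
      split: prod.splits if_splits)

lemma nf_mult_defined_series_in_A: "nf_mult_defined X (series_in_A v)"
  by (rule nf_mult_definedI[OF _ mult_series_in_A_support]) auto

lemma mult_series_in_A: "(X \<odot> series_in_A v) p q = (\<Sum>k\<le>q. X p k * v (q - k))"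
proof -
  have "(X \<odot> series_in_A v) p q =
      sum (nf_mult_term X (series_in_A v) p q) ((\<lambda>k. (p, k, 0, q - k)) ` {..q})"
    by (rule nf_mult_eq_sum[OF _ mult_series_in_A_support]) auto
  also have "\<dots> = (\<Sum>k\<le>q. X p k * v (q - k))"
    by (subst sum.reindex)
      (auto simp: inj_on_def nf_mult_term_def series_in_A_def reorder_coeff_no_B_right
        intro!: sum.cong)
  finally show ?thesis .
qed

lemma nf_A_eq_series_in_A: "nf_A = series_in_A (\<lambda>l. if l = 1 then 1 else 0)"
  by (auto simp: nf_A_def series_in_A_def fun_eq_iff)

lemma mult_nf_A: "(X \<odot> nf_A) p q = (if q = 0 then 0 else X p (q - 1))"
proof -
  have "(X \<odot> nf_A) p q = (\<Sum>k\<le>q. if k = q - 1 \<and> q \<noteq> 0 then X p k else 0)"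
    unfolding nf_A_eq_series_in_A mult_series_in_A by (intro sum.cong) auto
  then show ?thesis
    by (cases q) auto
qed

lemma T_mult_series_in_A:
  "(nf_T \<odot> series_in_A v) p q = (if p \<le> q then (- 2) ^ p / fact p * v (q - p) else 0)"
proof -
  have "(nf_T \<odot> series_in_A v) p q = (\<Sum>k\<le>q. if k = p then (- 2) ^ p / fact p * v (q - p) else 0)"
    unfolding mult_series_in_A by (intro sum.cong) (auto simp: nf_T_def)
  then show ?thesis
    by simp
qed

lemma B_mult_series_in_A_assoc:
  "nf_B \<odot> X \<odot> series_in_A v = nf_B \<odot> (X \<odot> series_in_A v)"
  by (simp add: fun_eq_iff mult_series_in_A nf_B_mult)

section \<open>The anticommutator with A on series\<close>

definition anticomm_A :: "nf_series \<Rightarrow> nf_series" where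
  "anticomm_A X = nf_A \<odot> X + X \<odot> nf_A"

lemma anticomm_A_coeff:
  "anticomm_A X p q = 2 * (if q = 0 then 0 else X p (q - 1)) + of_nat (Suc p) * X (Suc p) q"
  by (simp add: anticomm_A_def nf_A_mult mult_nf_A)

lemma anticomm_A_add: "anticomm_A (X + Y) = anticomm_A X + anticomm_A Y"
  by (simp add: fun_eq_iff anticomm_A_coeff algebra_simps)

text \<open>
  The coefficient formula can be solved for \<open>X (p + 1) q\<close>, which makes it a recursion in the power
  of \<open>B\<close>.
\<close>
lemma anticomm_row_determined:
  assumes "anticomm_A X = anticomm_A Y" and "X 0 = Y 0"
  shows "X = Y"
proof -
  have "X p = Y p" for p
  proof (induction p)
    case 0
    show ?case by (fact assms(2))
  next
    case (Suc p)
    have "of_nat (Suc p) * X (Suc p) q = of_nat (Suc p) * Y (Suc p) q" for q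
      using fun_cong[OF fun_cong[OF assms(1)], of p q]
      unfolding anticomm_A_coeff by (simp add: Suc.IH del: of_nat_Suc split: if_splits)
    then show ?case
      by (simp add: fun_eq_iff del: of_nat_Suc)
  qed
  then show ?thesis ..
qed

text \<open>
  The coefficients \<open>c p = (-2)^p / p!\<close> of \<open>T\<close> solve \<open>2 c p + (p + 1) c (p + 1) = 0\<close>, which is what the
  recursion requires along each diagonal.
\<close>
lemma anticomm_A_T: "anticomm_A (nf_T \<odot> series_in_A v) = 0"
proof -
  have step: "2 * ((- 2) ^ p / fact p) + of_nat (Suc p) * ((- 2) ^ Suc p / fact (Suc p)) = (0::complex)"
    for p by (simp add: divide_simps del: of_nat_Suc)
  show ?thesis
  proof (intro ext)
    fix p q
    show "anticomm_A (nf_T \<odot> series_in_A v) p q = 0 p q"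
    proof (cases "Suc p \<le> q")
      case True
      then have "p \<le> q - 1" "q \<noteq> 0" "q - 1 - p = q - Suc p"
        by auto
      with True have "anticomm_A (nf_T \<odot> series_in_A v) p q =
          (2 * ((- 2) ^ p / fact p) + of_nat (Suc p) * ((- 2) ^ Suc p / fact (Suc p))) * v (q - Suc p)"
        by (simp add: anticomm_A_coeff T_mult_series_in_A algebra_simps 
            del: of_nat_Suc fact_Suc power_Suc)
      then show ?thesis
        unfolding step by simp
    next
      case False
      then show ?thesis
        by (auto simp: anticomm_A_coeff T_mult_series_in_A)
    qed
  qed
qed

text \<open>
  The commutation relation \<open>A B = B A + I\<close> gives \<open>A (B X) + (B X) A = X + B (A X + X A)\<close>.
\<close>
lemma anticomm_A_B_mult: "anticomm_A (nf_B \<odot> X) = X + nf_B \<odot> anticomm_A X"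
proof (intro ext)
  fix p q
  show "anticomm_A (nf_B \<odot> X) p q = (X + nf_B \<odot> anticomm_A X) p q"
    by (cases p) (auto simp: anticomm_A_coeff nf_B_mult algebra_simps)
qed

lemma anticomm_A_BT: "anticomm_A (nf_B \<odot> nf_T \<odot> series_in_A w) = nf_T \<odot> series_in_A w"
  by (simp add: B_mult_series_in_A_assoc anticomm_A_B_mult anticomm_A_T) (simp add: fun_eq_iff nf_B_mult)

lemma row_zero_T: "(nf_T \<odot> series_in_A v) 0 = v"
  by (simp add: fun_eq_iff T_mult_series_in_A)

lemma row_zero_BT: "(nf_B \<odot> nf_T \<odot> series_in_A w) 0 = 0"
  by (simp add: fun_eq_iff B_mult_series_in_A_assoc nf_B_mult)

theorem anticomm_series_solutions:
  "anticomm_A A2 = A3 \<and> anticomm_A A3 = 0 \<longleftrightarrow>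
     (\<exists>v w. A2 = nf_T \<odot> series_in_A v + nf_B \<odot> nf_T \<odot> series_in_A w \<and> A3 = nf_T \<odot> series_in_A w)"
proof
  assume rel: "anticomm_A A2 = A3 \<and> anticomm_A A3 = 0"
  have A3: "A3 = nf_T \<odot> series_in_A (A3 0)"
    by (rule anticomm_row_determined) (simp_all add: rel anticomm_A_T row_zero_T)
  have "A2 = nf_T \<odot> series_in_A (A2 0) + nf_B \<odot> nf_T \<odot> series_in_A (A3 0)"
    by (rule anticomm_row_determined)
      (simp_all add: rel anticomm_A_add anticomm_A_T anticomm_A_BT row_zero_T row_zero_BT flip: A3)
  with A3 show "\<exists>v w. A2 = nf_T \<odot> series_in_A v + nf_B \<odot> nf_T \<odot> series_in_A w \<and>
      A3 = nf_T \<odot> series_in_A w"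
    by blast
next
  assume "\<exists>v w. A2 = nf_T \<odot> series_in_A v + nf_B \<odot> nf_T \<odot> series_in_A w \<and>
      A3 = nf_T \<odot> series_in_A w"
  then show "anticomm_A A2 = A3 \<and> anticomm_A A3 = 0"
    by (auto simp: anticomm_A_add anticomm_A_T anticomm_A_BT)
qed

section \<open>The relations for polynomials and for series\<close>

theorem theorem2p1:
  fixes scale :: "complex \<Rightarrow> 'a::{ring,monoid_mult} \<Rightarrow> 'a"
  shows
    "(\<forall>A B A2 A3 :: 'a.
        complex_algebra scale \<longrightarrow>
        A * B - B * A = 1 \<longrightarrow>
        A2 \<in> complex_algebra.polynomials_in scale {A, B} \<longrightarrow>
        A3 \<in> complex_algebra.polynomials_in scale {A, B} \<longrightarrow>
        A * A2 + A2 * A = A3 \<longrightarrow>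
        A * A3 + A3 * A = 0 \<longrightarrow>
        A2 = 0 \<and> A3 = 0)
     \<and>
     (\<forall>X :: nf_series. nf_mult_defined nf_A X \<and> nf_mult_defined X nf_A) \<and>
     nf_mult_defined nf_B nf_T \<and>
     (\<forall>v :: nat \<Rightarrow> complex.
        nf_mult_defined nf_T (series_in_A v) \<and>
        nf_mult_defined (nf_B \<odot> nf_T) (series_in_A v)) \<and>
     (\<forall>A2 A3 :: nf_series.
        nf_A \<odot> A2 + A2 \<odot> nf_A = A3 \<and> nf_A \<odot> A3 + A3 \<odot> nf_A = 0 \<longleftrightarrow>
        (\<exists>v w :: nat \<Rightarrow> complex.
           A2 = nf_T \<odot> series_in_A v + nf_B \<odot> nf_T \<odot> series_in_A w \<and>
           A3 = nf_T \<odot> series_in_A w))"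
proof (intro conjI allI impI)
  fix A B A2 A3 :: 'a
  assume alg: "complex_algebra scale" and ccr: "A * B - B * A = 1"
    and A2: "A2 \<in> complex_algebra.polynomials_in scale {A, B}"
    and A3: "A3 \<in> complex_algebra.polynomials_in scale {A, B}"
    and rel2: "A * A2 + A2 * A = A3" and rel3: "A * A3 + A3 * A = 0"
  note eq_0 = complex_algebra.anticommuting_polynomial_eq_0[OF alg ccr]
  show "A3 = 0"
    by (rule eq_0[OF A3 rel3])
  with rel2 show "A2 = 0"
    by (intro eq_0[OF A2]) simp
next
  show "nf_mult_defined X nf_A" for X
    unfolding nf_A_eq_series_in_A by (rule nf_mult_defined_series_in_A)
qed (rule nf_mult_defined_A_left nf_mult_defined_B_left nf_mult_defined_series_in_A
    anticomm_series_solutions[unfolded anticomm_A_def])+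

end
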